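(* For each $n\equiv 2 \pmod{3}$ with $n\geq 8$, a maximum $(C_6,\overline{C}_6)$-multipacking of $K_n$ has a leave of cardinality $1$. Furthermore, a maximum $(C_6,\overline{C}_6)$-multipacking of $K_7$ has a leave of cardinality $6$, and a maximum $(C_6,\overline{C}_6)$-multipacking of either $K_9$ or $K_{10}$ has a leave of cardinality $3$.
   Context: $C_6$ denotes the cycle on 6 vertices and $\overline{C}_6$ denotes its complement in $K_6$ (two disjoint triangles $\{a,b,c\}$, $\{d,e,f\}$ together with the edges $\{a,d\},\{b,e\},\{c,f\}$; 9 edges). For graphs $G$ and $H$, a $(G,H)$-multipacking of $K_n$ is a collection of edge-disjoint subgraphs of $K_n$, each isomorphic to $G$ or to $H$, containing at least one copy of $G$ and at least one copy of $H$. The leave of a multipacking is the set of edges of $K_n$ not belonging to any subgraph in the collection. A multipacking is maximum if its leave has minimum cardinality among all $(G,H)$-multipackings of $K_n$. *)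

theory Defs
  imports Main
begin

text \<open>Finite simple graphs: a vertex set together with a set of two-element sets of vertices.\<close>

type_synonym 'a graph = "'a set \<times> 'a set set"

abbreviation verts :: "'a graph \<Rightarrow> 'a set" where
  "verts G \<equiv> fst G"

abbreviation edges :: "'a graph \<Rightarrow> 'a set set" where
  "edges G \<equiv> snd G"

definition pairs_of :: "'a set \<Rightarrow> 'a set set" where
  "pairs_of V = {e. e \<subseteq> V \<and> card e = 2}"

definition simple_graph :: "'a graph \<Rightarrow> bool" where
  "simple_graph G \<longleftrightarrow> finite (verts G) \<and> edges G \<subseteq> pairs_of (verts G)"

definition complement :: "'a graph \<Rightarrow> 'a graph" where
  "complement G = (verts G, pairs_of (verts G) - edges G)"

definition complete_graph :: "nat \<Rightarrow> nat graph" where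
  "complete_graph n = ({0..<n}, pairs_of {0..<n})"

text \<open>The result is a simple graph, and a cycle, only for \<open>n \<ge> 3\<close>.\<close>

definition cycle_graph :: "nat \<Rightarrow> nat graph" where
  "cycle_graph n = ({0..<n}, {{i, (i + 1) mod n} | i. i < n})"

definition subgraph :: "'a graph \<Rightarrow> 'a graph \<Rightarrow> bool" where
  "subgraph S G \<longleftrightarrow> simple_graph S \<and> verts S \<subseteq> verts G \<and> edges S \<subseteq> edges G"

definition graph_iso :: "'a graph \<Rightarrow> 'b graph \<Rightarrow> bool" where
  "graph_iso G H \<longleftrightarrow> (\<exists>f. bij_betw f (verts G) (verts H) \<and>
     (\<forall>x\<in>verts G. \<forall>y\<in>verts G. {x, y} \<in> edges G \<longleftrightarrow> {f x, f y} \<in> edges H))"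

text \<open>Members of a multipacking are pairwise edge-disjoint and, whenever \<open>G\<close> and \<open>H\<close> have edges,
  have edges themselves, so no copy can be repeated and a set of subgraphs suffices.\<close>

definition multipacking :: "'a graph \<Rightarrow> 'a graph \<Rightarrow> 'b graph \<Rightarrow> 'b graph set \<Rightarrow> bool" where
  "multipacking G H K P \<longleftrightarrow>
     (\<forall>S\<in>P. subgraph S K \<and> (graph_iso S G \<or> graph_iso S H)) \<and>
     (\<forall>S\<in>P. \<forall>T\<in>P. S \<noteq> T \<longrightarrow> edges S \<inter> edges T = {}) \<and>
     (\<exists>S\<in>P. graph_iso S G) \<and> (\<exists>S\<in>P. graph_iso S H)"

definition leave :: "'b graph \<Rightarrow> 'b graph set \<Rightarrow> 'b set set" where
  "leave K P = edges K - (\<Union>S\<in>P. edges S)"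

definition maximum_multipacking :: "'a graph \<Rightarrow> 'a graph \<Rightarrow> 'b graph \<Rightarrow> 'b graph set \<Rightarrow> bool" where
  "maximum_multipacking G H K P \<longleftrightarrow> multipacking G H K P \<and>
     (\<forall>Q. multipacking G H K Q \<longrightarrow> card (leave K P) \<le> card (leave K Q))"

lemma edges_cycle_graph_6:
  "edges (cycle_graph 6) = {{0,1}, {1,2}, {2,3}, {3,4}, {4,5}, {5,0}}"
proof -
  have V: "{i. i < 6} = {0,1,2,3,4,5::nat}"
    by auto
  have "edges (cycle_graph 6) = (\<lambda>i. {i, (i + 1) mod 6}) ` {i. i < 6}"
    by (simp only: cycle_graph_def snd_conv setcompr_eq_image)
  then show ?thesis
    unfolding V by (simp flip: numeral_2_eq_2)
qed

text \<open>Two triangles joined by a perfect matching.\<close>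

lemma edges_complement_cycle_graph_6:
  "edges (complement (cycle_graph 6)) =
     {{0,2}, {2,4}, {4,0}, {3,5}, {5,1}, {1,3}, {0,3}, {2,5}, {4,1}}"
proof -
  have V: "{0..<6::nat} = {0,1,2,3,4,5}"
    by auto
  have P: "pairs_of {0..<6::nat} =
     {{0,1}, {1,2}, {2,3}, {3,4}, {4,5}, {5,0},
      {0,2}, {2,4}, {4,0}, {3,5}, {5,1}, {1,3}, {0,3}, {2,5}, {4,1}}"
    (is "_ = ?R")
  proof
    show "pairs_of {0..<6::nat} \<subseteq> ?R"
    proof
      fix e :: "nat set"
      assume "e \<in> pairs_of {0..<6}"
      then obtain x y where e: "e = {x, y}" and "x \<noteq> y"
        and "x \<in> {0,1,2,3,4,5}" and "y \<in> {0,1,2,3,4,5}"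
        unfolding pairs_of_def V mem_Collect_eq card_2_iff by blast
      from this(3,4,2) show "e \<in> ?R"
        unfolding e by (elim insertE emptyE) (simp_all add: doubleton_eq_iff)
    qed
    show "?R \<subseteq> pairs_of {0..<6::nat}"
      unfolding pairs_of_def by auto
  qed
  have "edges (complement (cycle_graph 6)) = pairs_of {0..<6} - edges (cycle_graph 6)"
    by (simp add: complement_def cycle_graph_def)
  then show ?thesis
    unfolding P edges_cycle_graph_6 by (simp add: insert_Diff_if doubleton_eq_iff)
qed

end

theory Submission
  imports Defs
begin

text \<open>
  Counting edges, with at least one copy of each graph, gives all lower bounds except that a leave
  could be empty for \<open>n = 7, 9, 10\<close>. If the leave is empty, every vertex \<open>v\<close> lies in \<open>t v\<close> prisms with \<open>t v \<equiv> n - 1\<close>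
  modulo 2. For \<open>n = 7\<close> there would be a single prism, whose vertices have \<open>t v = 1\<close>; for \<open>n = 9\<close>
  there would be two prisms on the same six vertices, which span only 15 edges. For \<open>n = 10\<close> there
  would be three prisms sharing four vertices; each has at least three edges among these four
  vertices, which span only six.

  Packings for small \<open>n\<close> are given explicitly. For \<open>n \<ge> 7\<close>, the edges of \<open>K\<^sub>n\<^sub>+\<^sub>6\<close> outside \<open>K\<^sub>n\<close> can be
  decomposed completely, so the leave of size 1 persists from \<open>n = 8\<close> and \<open>n = 11\<close>: for even \<open>n\<close>
  they form a \<open>K\<^sub>6\<close> (a hexagon and its complement) and a \<open>K\<^sub>6\<^sub>,\<^sub>n\<close>, built from copies of \<open>K\<^sub>6\<^sub>,\<^sub>4\<close> and
  \<open>K\<^sub>6\<^sub>,\<^sub>6\<close>; for odd \<open>n\<close> they form a \<open>K\<^sub>9\<close> without a triangle and a \<open>K\<^sub>6\<^sub>,\<^sub>n\<^sub>-\<^sub>3\<close>.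
\<close>

section \<open>Copies of a graph\<close>

abbreviation hexagon :: "nat graph" where
  "hexagon \<equiv> cycle_graph 6"

abbreviation prism :: "nat graph" where
  "prism \<equiv> complement (cycle_graph 6)"

text \<open>Packings are handled through vertex maps from one fixed graph. For a simple
  \<open>G\<close> and \<open>f\<close> injective on its vertices this is an isomorphic graph, and
  every simple graph isomorphic to \<open>G\<close> arises in this way.\<close>

definition copy :: "('a \<Rightarrow> 'b) \<Rightarrow> 'a graph \<Rightarrow> 'b graph" where
  "copy f G = (f ` verts G, (`) f ` edges G)"

lemma copy_copy: "copy f (copy g G) = copy (f \<circ> g) G"
  by (simp add: copy_def image_comp comp_def image_image)

lemma simple_graph_edges_Pow: "simple_graph G \<Longrightarrow> edges G \<subseteq> Pow (verts G)"
  by (auto simp: simple_graph_def pairs_of_def)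

lemma simple_graph_finite_edges: "simple_graph G \<Longrightarrow> finite (edges G)"
  using finite_subset simple_graph_edges_Pow simple_graph_def by (metis finite_Pow_iff)

lemma simple_graph_edgeE:
  assumes "simple_graph G" "e \<in> edges G"
  obtains u v where "e = {u, v}" "u \<noteq> v" "u \<in> verts G" "v \<in> verts G"
proof -
  have "e \<subseteq> verts G" "card e = 2"
    using assms by (auto simp: simple_graph_def pairs_of_def)
  then show ?thesis
    using that by (auto simp: card_2_iff)
qed

lemma inj_on_image_edges:
  assumes "simple_graph G" "inj_on f (verts G)"
  shows "inj_on ((`) f) (edges G)"
  using inj_on_subset[OF inj_on_image_Pow simple_graph_edges_Pow] assms by blast

lemma pairs_of_image:
  assumes "inj_on f V"
  shows "pairs_of (f ` V) = (`) f ` pairs_of V"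
proof
  show "pairs_of (f ` V) \<subseteq> (`) f ` pairs_of V"
  proof
    fix e assume "e \<in> pairs_of (f ` V)"
    then obtain d where "d \<subseteq> V" "e = f ` d" "card e = 2"
      by (auto simp: pairs_of_def subset_image_iff)
    with assms show "e \<in> (`) f ` pairs_of V"
      by (auto simp: pairs_of_def card_image inj_on_subset)
  qed
  show "(`) f ` pairs_of V \<subseteq> pairs_of (f ` V)"
    using assms by (auto simp: pairs_of_def card_image inj_on_subset)
qed

lemma simple_graph_copy:
  assumes "simple_graph G" "inj_on f (verts G)"
  shows "simple_graph (copy f G)"
  using assms pairs_of_image[OF assms(2)] by (auto simp: simple_graph_def copy_def)

lemma graph_iso_copy:
  assumes "simple_graph G" "inj_on f (verts G)"
  shows "graph_iso (copy f G) G"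
proof -
  let ?g = "the_inv_into (verts G) f"
  have "bij_betw ?g (f ` verts G) (verts G)"
    using assms(2) bij_betw_the_inv_into inj_on_imp_bij_betw by blast
  moreover have "f ` {u, v} \<in> (`) f ` edges G \<longleftrightarrow> {u, v} \<in> edges G"
    if "u \<in> verts G" "v \<in> verts G" for u v
    using inj_on_image_mem_iff[OF inj_on_image_Pow[OF assms(2)] _ simple_graph_edges_Pow[OF assms(1)],
        of "{u, v}"] that by simp
  ultimately show ?thesis
    using assms(2) unfolding graph_iso_def copy_def
    by (intro exI[of _ ?g]) (auto simp: the_inv_into_f_f)
qed

text \<open>The inverse of the isomorphism is the required vertex map. Simplicity of both graphs
  matters because \<open>graph_iso\<close> compares only edges of the form
  \<open>{x, y}\<close>.\<close>

lemma graph_isoE: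
  assumes "graph_iso S G" "simple_graph S" "simple_graph G"
  obtains f where "inj_on f (verts G)" "S = copy f G"
proof -
  obtain g where g: "bij_betw g (verts S) (verts G)"
    and E: "\<And>x y. x \<in> verts S \<Longrightarrow> y \<in> verts S \<Longrightarrow> {x, y} \<in> edges S \<longleftrightarrow> {g x, g y} \<in> edges G"
    using assms(1) by (auto simp: graph_iso_def)
  define f where "f = the_inv_into (verts S) g"
  have f: "bij_betw f (verts G) (verts S)"
    unfolding f_def by (rule bij_betw_the_inv_into[OF g])
  have gf: "g (f u) = u" if "u \<in> verts G" for u
    using that g unfolding f_def by (simp add: f_the_inv_into_f_bij_betw)
  have fg: "f (g x) = x" if "x \<in> verts S" for x
    using that g unfolding f_def by (simp add: bij_betw_def the_inv_into_f_f)
  have fV: "f u \<in> verts S" if "u \<in> verts G" for u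
    using that f by (auto simp: bij_betw_def)
  have gV: "g x \<in> verts G" if "x \<in> verts S" for x
    using that g by (auto simp: bij_betw_def)
  have "edges S = (`) f ` edges G"
  proof
    show "edges S \<subseteq> (`) f ` edges G"
    proof
      fix e assume e: "e \<in> edges S"
      then obtain x y where xy: "e = {x, y}" "x \<in> verts S" "y \<in> verts S"
        using simple_graph_edgeE[OF assms(2)] by metis
      then have "{g x, g y} \<in> edges G" "e = f ` {g x, g y}"
        using E e fg by auto
      then show "e \<in> (`) f ` edges G" by blast
    qed
    show "(`) f ` edges G \<subseteq> edges S"
    proof
      fix e assume "e \<in> (`) f ` edges G"
      then obtain d where d: "d \<in> edges G" "e = f ` d" by blast
      then obtain u v where uv: "d = {u, v}" "u \<in> verts G" "v \<in> verts G"
        using simple_graph_edgeE[OF assms(3)] by metis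
      then have "{f u, f v} \<in> edges S"
        using E[OF fV[of u] fV[of v]] d(1) gf[of u] gf[of v] by metis
      then show "e \<in> edges S"
        by (simp add: d(2) uv(1))
    qed
  qed
  then have "S = copy f G"
    using f by (simp add: copy_def bij_betw_def prod_eq_iff)
  then show ?thesis
    using that f by (auto simp: bij_betw_def)
qed

section \<open>Degrees and edge counts of the hexagon and the prism\<close>

definition degree :: "'a graph \<Rightarrow> 'a \<Rightarrow> nat" where
  "degree G v = card {e \<in> edges G. v \<in> e}"

lemma degree_copy:
  assumes "simple_graph G" "inj_on f (verts G)" "u \<in> verts G"
  shows "degree (copy f G) (f u) = degree G u"
proof -
  have "f u \<in> f ` e \<longleftrightarrow> u \<in> e" if "e \<in> edges G" for e
    using inj_on_image_mem_iff[OF assms(2,3)] simple_graph_edges_Pow[OF assms(1)] that by blast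
  then have "{e \<in> edges G. u \<in> e} = {e \<in> edges G. f u \<in> f ` e}"
    by blast
  then have "{e \<in> edges (copy f G). f u \<in> e} = (`) f ` {e \<in> edges G. u \<in> e}"
    unfolding copy_def snd_conv by blast
  moreover have "inj_on ((`) f) {e \<in> edges G. u \<in> e}"
    using inj_on_image_edges[OF assms(1,2)] by (rule inj_on_subset) auto
  ultimately show ?thesis
    by (simp add: degree_def card_image)
qed

lemma degree_notin_verts: "simple_graph G \<Longrightarrow> v \<notin> verts G \<Longrightarrow> degree G v = 0"
  using simple_graph_edges_Pow[of G] by (auto simp: degree_def card_eq_0_iff)

lemma verts_cycle_graph_6: "verts (cycle_graph 6) = {0, 1, 2, 3, 4, 5}"
  by (auto simp: cycle_graph_def)

lemma verts_prism: "verts prism = {0, 1, 2, 3, 4, 5}"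
  using verts_cycle_graph_6 by (simp add: complement_def)

lemma simple_graph_hexagon: "simple_graph hexagon"
  unfolding simple_graph_def verts_cycle_graph_6 edges_cycle_graph_6 pairs_of_def by simp

lemma simple_graph_prism: "simple_graph prism"
  unfolding simple_graph_def verts_prism edges_complement_cycle_graph_6 pairs_of_def by simp

lemma card_edges_hexagon: "card (edges hexagon) = 6"
  unfolding edges_cycle_graph_6 by (simp add: doubleton_eq_iff card_insert_if)

lemma card_edges_prism: "card (edges prism) = 9"
  unfolding edges_complement_cycle_graph_6 by (simp add: doubleton_eq_iff card_insert_if)

text \<open>Evaluates the set of edges at a vertex by running through an explicit edge set.\<close>

lemma Collect_insert_conv:
  "{x \<in> insert a A. P x} = (if P a then insert a {x \<in> A. P x} else {x \<in> A. P x})"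
  by auto

lemma degree_hexagon: "u \<in> verts hexagon \<Longrightarrow> degree hexagon u = 2"
  unfolding verts_cycle_graph_6 degree_def edges_cycle_graph_6 Collect_insert_conv
  by (elim insertE emptyE) (simp_all add: doubleton_eq_iff card_insert_if)

lemma degree_prism: "u \<in> verts prism \<Longrightarrow> degree prism u = 3"
  unfolding verts_prism degree_def edges_complement_cycle_graph_6 Collect_insert_conv
  by (elim insertE emptyE) (simp_all add: doubleton_eq_iff card_insert_if)

section \<open>Decompositions into hexagons and prisms\<close>

abbreviation is_block :: "'a graph \<Rightarrow> bool" where
  "is_block S \<equiv> simple_graph S \<and> (graph_iso S hexagon \<or> graph_iso S prism)"

text \<open>Unlike a multipacking, this names no host graph and does not ask for both kinds of
  block, so pieces made of hexagons alone qualify and can be glued together.\<close>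

definition decomposition :: "'a graph set \<Rightarrow> 'a set set \<Rightarrow> bool" where
  "decomposition P E \<longleftrightarrow> (\<forall>S\<in>P. is_block S) \<and>
     (\<forall>S\<in>P. \<forall>T\<in>P. S \<noteq> T \<longrightarrow> edges S \<inter> edges T = {}) \<and> (\<Union>S\<in>P. edges S) = E"

lemma blockE:
  assumes "is_block S"
  obtains f G where "G = hexagon \<or> G = prism" "inj_on f (verts G)" "S = copy f G"
  using assms graph_isoE[OF _ _ simple_graph_hexagon] graph_isoE[OF _ _ simple_graph_prism]
  by metis

lemma block_copy:
  assumes "is_block S" "inj_on f (verts S)"
  shows "is_block (copy f S)"
proof -
  obtain g G where G: "G = hexagon \<or> G = prism" and g: "inj_on g (verts G)" "S = copy g G"
    using blockE assms(1) by metis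
  then have "copy f S = copy (f \<circ> g) G" "inj_on (f \<circ> g) (verts G)"
    using assms(2) by (auto simp: copy_copy copy_def intro: comp_inj_on)
  moreover have "simple_graph G"
    using G simple_graph_hexagon simple_graph_prism by blast
  ultimately show ?thesis
    using G graph_iso_copy[of G "f \<circ> g"] simple_graph_copy[of G "f \<circ> g"] by auto
qed

text \<open>Neither the hexagon nor the prism has an isolated vertex. Hence a block is determined by
  its edges.\<close>

lemma verts_block: "is_block S \<Longrightarrow> verts S = \<Union> (edges S)"
proof -
  assume "is_block S"
  then obtain f G where G: "G = hexagon \<or> G = prism" "S = copy f G"
    using blockE by metis
  have "verts G = \<Union> (edges G)"
    using G(1) unfolding edges_cycle_graph_6 edges_complement_cycle_graph_6
    by (auto simp: verts_cycle_graph_6 verts_prism edges_cycle_graph_6 edges_complement_cycle_graph_6)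
  then show ?thesis
    by (simp add: G(2) copy_def image_Union)
qed

lemma decomposition_Un:
  assumes "decomposition P E" "decomposition Q F" "E \<inter> F = {}"
  shows "decomposition (P \<union> Q) (E \<union> F)"
proof -
  have "edges S \<inter> edges T = {} \<and> edges T \<inter> edges S = {}" if "S \<in> P" "T \<in> Q" for S T
    using assms that unfolding decomposition_def by blast
  then have "\<forall>S\<in>P \<union> Q. \<forall>T\<in>P \<union> Q. S \<noteq> T \<longrightarrow> edges S \<inter> edges T = {}"
    using assms(1,2) unfolding decomposition_def by (simp add: ball_Un)
  then show ?thesis
    using assms(1,2) unfolding decomposition_def by (simp add: ball_Un UN_Un)
qed

text \<open>Injectivity on the vertices covered by \<open>E\<close> suffices, because a block has no
  vertices outside its edges.\<close>

lemma decomposition_image: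
  assumes "decomposition P E" "inj_on f (\<Union> E)"
  shows "decomposition (copy f ` P) ((`) f ` E)"
proof -
  have sub: "edges S \<subseteq> E" if "S \<in> P" for S
    using assms(1) that by (auto simp: decomposition_def)
  have "is_block (copy f S)" if "S \<in> P" for S
  proof (rule block_copy)
    show "is_block S"
      using assms(1) that by (simp add: decomposition_def)
    then have "verts S = \<Union> (edges S)"
      by (rule verts_block)
    then show "inj_on f (verts S)"
      using inj_on_subset[OF assms(2)] Union_mono[OF sub[OF that]] by simp
  qed
  moreover have "edges (copy f S) \<inter> edges (copy f T) = {}"
    if "S \<in> P" "T \<in> P" "copy f S \<noteq> copy f T" for S T
  proof -
    have "S \<noteq> T"
      using that(3) by blast
    with that have "edges S \<inter> edges T = {}"
      using assms(1) by (simp add: decomposition_def)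
    moreover have "edges S \<subseteq> Pow (\<Union> E)" "edges T \<subseteq> Pow (\<Union> E)"
      using sub[OF that(1)] sub[OF that(2)] by blast+
    ultimately show ?thesis
      using inj_on_image_Int[OF inj_on_image_Pow[OF assms(2)], of "edges S" "edges T"]
      by (simp add: copy_def)
  qed
  moreover have "(\<Union>S\<in>copy f ` P. edges S) = (`) f ` (\<Union>S\<in>P. edges S)"
    unfolding copy_def by auto
  ultimately show ?thesis
    using assms(1) by (simp add: decomposition_def)
qed

definition decomposable :: "'a set set \<Rightarrow> bool" where
  "decomposable E \<longleftrightarrow> (\<exists>P. decomposition P E)"

lemma decomposable_Un:
  "decomposable E \<Longrightarrow> decomposable F \<Longrightarrow> E \<inter> F = {} \<Longrightarrow> decomposable (E \<union> F)"
  unfolding decomposable_def using decomposition_Un by blast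

lemma decomposable_image:
  "decomposable E \<Longrightarrow> inj_on f (\<Union> E) \<Longrightarrow> decomposable ((`) f ` E)"
  unfolding decomposable_def using decomposition_image by blast

text \<open>The explicit packings were found by computer search. A block is given by the list of the images
  of \<open>0, \<dots>, 5\<close>, with \<open>True\<close> for a hexagon and \<open>False\<close> for a prism; ordering the end points makes
  disjointness checkable as distinctness of a list of pairs.\<close>

definition block_pairs :: "bool \<times> nat list \<Rightarrow> (nat \<times> nat) list" where
  "block_pairs b = map (\<lambda>(i, j). (min (snd b ! i) (snd b ! j), max (snd b ! i) (snd b ! j)))
     (if fst b then [(0,1), (1,2), (2,3), (3,4), (4,5), (5,0)]
      else [(0,2), (2,4), (4,0), (3,5), (5,1), (1,3), (0,3), (2,5), (4,1)])"

definition block_graph :: "bool \<times> nat list \<Rightarrow> nat graph" where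
  "block_graph b = copy ((!) (snd b)) (if fst b then hexagon else prism)"

abbreviation unordered :: "'a \<times> 'a \<Rightarrow> 'a set" where
  "unordered \<equiv> \<lambda>(a, b). {a, b}"

lemma edges_block_graph: "edges (block_graph b) = unordered ` set (block_pairs b)"
proof -
  have mm: "{min x y, max x y} = {x, y}" for x y :: nat
    by (auto simp: min_def max_def)
  show ?thesis
    by (simp add: block_graph_def block_pairs_def copy_def edges_cycle_graph_6
        edges_complement_cycle_graph_6 mm)
qed

text \<open>Lets disjointness and cardinality of edge sets be read off from sets of ordered
  pairs.\<close>

lemma inj_on_unordered: "inj_on unordered {(a, b). a < (b :: nat)}"
  by (auto simp: inj_on_def doubleton_eq_iff)

text \<open>Stated with executable list functions so that evaluation decides it. Distinctness of the
  concatenation also excludes listing a block twice.\<close>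

definition valid_blocks :: "(bool \<times> nat list) list \<Rightarrow> bool" where
  "valid_blocks bs \<longleftrightarrow> (\<forall>b\<in>set bs. distinct (snd b) \<and> length (snd b) = 6) \<and>
     distinct (concat (map block_pairs bs))"

lemma block_graph:
  assumes "distinct (snd b)" "length (snd b) = 6"
  shows "simple_graph (block_graph b)"
    and "graph_iso (block_graph b) (if fst b then hexagon else prism)"
proof -
  have "inj_on ((!) (snd b)) (verts (if fst b then hexagon else prism))"
    using assms by (intro inj_on_nth) (auto simp: verts_cycle_graph_6 verts_prism)
  then show "simple_graph (block_graph b)"
    and "graph_iso (block_graph b) (if fst b then hexagon else prism)"
    using simple_graph_hexagon simple_graph_prism
    by (auto simp: block_graph_def simple_graph_copy graph_iso_copy)
qed

lemma block_pairs_less: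
  assumes "distinct (snd b)" "length (snd b) = 6" "(x, y) \<in> set (block_pairs b)"
  shows "x < y"
proof -
  have "min (snd b ! i) (snd b ! j) < max (snd b ! i) (snd b ! j)" if "i < 6" "j < 6" "i \<noteq> j" for i j
    using assms(1,2) that by (metis linorder_neqE_nat max_def min_def nth_eq_iff_index_eq order_less_imp_le leD)
  then show ?thesis
    using assms(3) by (auto simp: block_pairs_def split: if_splits)
qed

lemma decomposition_blocks:
  assumes "valid_blocks bs"
  shows "decomposition (block_graph ` set bs) (unordered ` set (concat (map block_pairs bs)))"
    and "set (concat (map block_pairs bs)) \<subseteq> {(a, b). a < b}"
proof -
  have len: "distinct (snd b)" "length (snd b) = 6" if "b \<in> set bs" for b
    using assms that by (auto simp: valid_blocks_def)
  show less: "set (concat (map block_pairs bs)) \<subseteq> {(a, b). a < b}"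
    using block_pairs_less[OF len] by auto
  have block: "is_block (block_graph b)" if "b \<in> set bs" for b
    using block_graph[OF len[OF that]] by (auto split: if_splits)
  have "edges (block_graph b) \<inter> edges (block_graph c) = {}"
    if "b \<in> set bs" "c \<in> set bs" "block_graph b \<noteq> block_graph c" for b c
  proof -
    \<comment> \<open>Distinctness of a concatenation separates only members that differ as lists.
      Equal pair lists would give equal edges, hence equal vertices and equal graphs.\<close>
    have "block_pairs b \<noteq> block_pairs c"
    proof
      assume "block_pairs b = block_pairs c"
      then have "edges (block_graph b) = edges (block_graph c)"
        by (simp add: edges_block_graph)
      then show False
        using that block verts_block[of "block_graph b"] verts_block[of "block_graph c"]
        by (simp add: prod_eq_iff)
    qed
    then have "set (block_pairs b) \<inter> set (block_pairs c) = {}"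
      using assms that(1,2) by (auto simp: valid_blocks_def distinct_concat_iff)
    then show ?thesis
      using inj_on_image_Int[OF inj_on_unordered, of "set (block_pairs b)" "set (block_pairs c)"]
        less that unfolding edges_block_graph by auto
  qed
  with block show "decomposition (block_graph ` set bs) (unordered ` set (concat (map block_pairs bs)))"
    unfolding decomposition_def by (auto simp: edges_block_graph)
qed

section \<open>Decomposing the edges at six new vertices\<close>

text \<open>For disjoint \<open>X\<close> and \<open>Y\<close> these are the edges of the complete
  bipartite graph between them.\<close>

definition cross :: "'a set \<Rightarrow> 'a set \<Rightarrow> 'a set set" where
  "cross X Y = (\<Union>x\<in>X. \<Union>y\<in>Y. {{x, y}})"

lemma cross_Un: "cross X (Y \<union> Z) = cross X Y \<union> cross X Z"
  by (auto simp: cross_def)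

lemma cross_image: "cross (f ` X) (f ` Y) = (`) f ` cross X Y"
  by (simp add: cross_def image_UN)

lemma pairs_of_Un_disjoint:
  assumes "X \<inter> Y = {}"
  shows "pairs_of (X \<union> Y) = pairs_of X \<union> pairs_of Y \<union> cross X Y"
proof
  show "pairs_of (X \<union> Y) \<subseteq> pairs_of X \<union> pairs_of Y \<union> cross X Y"
  proof
    fix e assume "e \<in> pairs_of (X \<union> Y)"
    then obtain u v where "e = {u, v}" "u \<noteq> v" "u \<in> X \<union> Y" "v \<in> X \<union> Y"
      by (auto simp: pairs_of_def card_2_iff)
    then show "e \<in> pairs_of X \<union> pairs_of Y \<union> cross X Y"
      by (auto simp: pairs_of_def cross_def insert_commute)
  qed
  have "{x, y} \<in> pairs_of (X \<union> Y)" if "x \<in> X" "y \<in> Y" for x y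
    using that assms by (auto simp: pairs_of_def card_insert_if)
  then show "pairs_of X \<union> pairs_of Y \<union> cross X Y \<subseteq> pairs_of (X \<union> Y)"
    by (auto simp: pairs_of_def cross_def)
qed

lemma pairs_of_upto: "pairs_of {0..<n} = unordered ` {(a, b). a < b \<and> b < (n :: nat)}"
proof
  show "pairs_of {0..<n} \<subseteq> unordered ` {(a, b). a < b \<and> b < n}"
  proof
    fix e assume "e \<in> pairs_of {0..<n}"
    then obtain u v where "e = {u, v}" "u \<noteq> v" "u < n" "v < n"
      by (auto simp: pairs_of_def card_2_iff)
    then have "e = unordered (min u v, max u v)" "min u v < max u v" "max u v < n"
      by (auto simp: min_def max_def)
    then show "e \<in> unordered ` {(a, b). a < b \<and> b < n}"
      by blast
  qed
qed (auto simp: pairs_of_def)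

lemma cross_conv: "cross X Y = unordered ` (X \<times> Y)"
  by (auto simp: cross_def)

text \<open>The list \<open>ps\<close> enumerates the edges to be covered. The last two premises are
  the two inclusions between it and the edges of the blocks, in a form that can be
  evaluated.\<close>

lemma decomposable_blocks:
  assumes "valid_blocks bs" "unordered ` set ps = E"
    and "list_all (\<lambda>p. p \<in> set ps) (concat (map block_pairs bs))"
    and "list_all (\<lambda>p. p \<in> set (concat (map block_pairs bs))) ps"
  shows "decomposable E"
proof -
  have "set ps = set (concat (map block_pairs bs))"
    using assms(3,4) unfolding list_all_iff by blast
  then show ?thesis
    using decomposition_blocks(1)[OF assms(1)] assms(2) unfolding decomposable_def by metis
qed

section \<open>Explicit decompositions of the building pieces\<close>

lemma decomposable_K6: "decomposable (pairs_of {0..<6::nat})"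
proof (rule decomposable_blocks)
  show "valid_blocks [(True, [0,1,2,3,4,5]), (False, [0,1,2,3,4,5])]"
    by code_simp
  show "unordered ` set (filter (\<lambda>(a, b). a < b) (List.product [0..<6] [0..<6])) = pairs_of {0..<6}"
    unfolding pairs_of_upto by (rule arg_cong[where f = "image unordered"]) auto
qed code_simp+

text \<open>A prism contains triangles, so a bipartite piece has to consist of hexagons: here 24
  edges in four of them.\<close>

lemma decomposable_K_6_4: "decomposable (cross {0..<6} {6..<10::nat})"
proof (rule decomposable_blocks)
  show "valid_blocks [(True, [0,7,1,6,2,8]), (True, [2,7,5,6,3,9]), (True, [3,7,4,9,5,8]),
      (True, [4,6,0,9,1,8])]"
    by code_simp
  show "unordered ` set (List.product [0..<6] [6..<10]) = cross {0..<6} {6..<10}"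
    by (simp only: cross_conv set_product set_upt)
qed code_simp+

lemma decomposable_K_6_6: "decomposable (cross {0..<6} {6..<12::nat})"
proof (rule decomposable_blocks)
  show "valid_blocks [(True, [4,9,0,8,5,11]), (True, [0,11,1,6,3,10]), (True, [3,11,2,6,4,7]),
      (True, [0,6,5,9,1,7]), (True, [5,7,2,8,1,10]), (True, [4,10,2,9,3,8])]"
    by code_simp
  show "unordered ` set (List.product [0..<6] [6..<12]) = cross {0..<6} {6..<12}"
    by (simp only: cross_conv set_product set_upt)
qed code_simp+

text \<open>The missing triangle \<open>6, 7, 8\<close> stands for edges among old vertices, which
  the new blocks must not touch. The 33 edges split into three prisms and a hexagon.\<close>

lemma decomposable_K9_minus_K3: "decomposable (pairs_of {0..<6} \<union> cross {0..<6} {6..<9::nat})"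
proof (rule decomposable_blocks)
  show "valid_blocks [(False, [5,2,8,6,0,1]), (False, [7,6,5,0,4,3]), (False, [2,3,4,7,8,1]),
      (True, [0,1,5,2,3,4])]"
    by code_simp
  \<comment> \<open>Keeping the smaller end point below 6 omits exactly the triangle on
    \<open>6, 7, 8\<close>.\<close>
  show "unordered ` set (filter (\<lambda>(a, b). a < b) (List.product [0..<6] [0..<9]))
      = pairs_of {0..<6} \<union> cross {0..<6} {6..<9}"
    unfolding pairs_of_upto cross_conv image_Un[symmetric]
    by (rule arg_cong[where f = "image unordered"]) auto
qed code_simp+

section \<open>Transfer to arbitrary vertex sets and gluing\<close>

lemma ex_inj_two_blocks:
  assumes "finite X" "finite Y" "card X = k" "card Y = l" "X \<inter> Y = {}"
  obtains f :: "nat \<Rightarrow> 'a" where "inj_on f {0..<k + l}" "f ` {0..<k} = X" "f ` {k..<k + l} = Y"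
proof -
  obtain g where g: "bij_betw g {0..<k} X"
    using ex_bij_betw_nat_finite[OF assms(1)] assms(3) by blast
  obtain h where h: "bij_betw h {0..<l} Y"
    using ex_bij_betw_nat_finite[OF assms(2)] assms(4) by blast
  define f where "f i = (if i < k then g i else h (i - k))" for i
  have X: "f ` {0..<k} = X"
    using g by (simp add: f_def bij_betw_def)
  have "f ` {k..<k + l} = h ` (\<lambda>i. i - k) ` {k..<k + l}"
    by (simp add: f_def image_image)
  also have "(\<lambda>i. i - k) ` {k..<k + l} = {0..<l}"
    using image_minus_const_atLeastLessThan_nat[of k k "k + l"] by simp
  finally have Y: "f ` {k..<k + l} = Y"
    using h by (simp add: bij_betw_def)
  have "f ` {0..<k + l} = X \<union> Y"
    using ivl_disj_un_two(3)[of 0 k "k + l"] X Y by (metis image_Un le0 le_add1)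
  \<comment> \<open>The image \<open>X \<union> Y\<close> has \<open>k + l\<close> elements, as many
    as the domain.\<close>
  then have "inj_on f {0..<k + l}"
    using assms by (intro eq_card_imp_inj_on) (auto simp: card_Un_disjoint)
  then show ?thesis
    using that X Y by blast
qed

text \<open>Serves both kinds of piece at once: \<open>A = {}\<close> for complete bipartite graphs,
  \<open>A = pairs_of {0..<6}\<close> for \<open>K_9\<close> without a triangle.\<close>

lemma decomposable_transfer:
  assumes "decomposable (A \<union> cross {0..<k} {k..<k + l})"
    and "A = {} \<or> A = pairs_of {0..<k}"
    and "finite X" "finite Y" "card X = k" "card Y = l" "X \<inter> Y = {}"
  shows "decomposable ((if A = {} then {} else pairs_of X) \<union> cross X Y)"
proof -
  obtain f :: "nat \<Rightarrow> 'a"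
    where f: "inj_on f {0..<k + l}" "f ` {0..<k} = X" "f ` {k..<k + l} = Y"
    using ex_inj_two_blocks assms by metis
  have "\<Union> (A \<union> cross {0..<k} {k..<k + l}) \<subseteq> {0..<k + l}"
    using assms(2) by (fastforce simp: pairs_of_def cross_def)
  then have "decomposable ((`) f ` (A \<union> cross {0..<k} {k..<k + l}))"
    using decomposable_image[OF assms(1)] inj_on_subset[OF f(1)] by blast
  moreover have "pairs_of X = (`) f ` pairs_of {0..<k}"
    using pairs_of_image[of f "{0..<k}"] inj_on_subset[OF f(1)] f(2) by simp
  ultimately show ?thesis
    using assms(2) cross_image[of f "{0..<k}" "{k..<k + l}"] f(2,3) by (auto simp: image_Un)
qed

lemma decomposable_pairs_of_6:
  assumes "finite X" "card X = 6"
  shows "decomposable (pairs_of X)"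
proof -
  have "\<Union> (pairs_of {0..<6}) \<subseteq> {0..<6::nat}"
    by (auto simp: pairs_of_def)
  moreover obtain f :: "nat \<Rightarrow> 'a" where f: "inj_on f {0..<6}" "f ` {0..<6} = X"
    using ex_bij_betw_nat_finite[OF assms(1)] assms(2) by (auto simp: bij_betw_def)
  ultimately show ?thesis
    using decomposable_image[OF decomposable_K6, of f] inj_on_subset pairs_of_image[of f "{0..<6}"]
    by metis
qed

text \<open>Copies of \<open>K_{6,4}\<close> are split off while \<open>Y\<close> has at least 8
  vertices, which leaves at least 4. Sizes 4 and 6 are the base cases; taking 4 from 6 would leave
  only 2.\<close>

lemma decomposable_cross:
  assumes "finite X" "card X = 6"
  shows "finite Y \<Longrightarrow> even (card Y) \<Longrightarrow> card Y \<ge> 4 \<Longrightarrow> X \<inter> Y = {} \<Longrightarrow> decomposable (cross X Y)"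
proof (induction "card Y" arbitrary: Y rule: less_induct)
  case less
  consider "card Y = 4" | "card Y = 6" | "card Y \<ge> 8"
  proof -
    obtain m where "card Y = 2 * m"
      using less.prems(2) by blast
    then show ?thesis
      using that less.prems(3) by (cases "m = 2 \<or> m = 3") auto
  qed
  then show ?case
  proof cases
    case 1
    then show ?thesis
      using decomposable_transfer[of "{}" 6 4 X Y] decomposable_K_6_4 assms less.prems by simp
  next
    case 2
    then show ?thesis
      using decomposable_transfer[of "{}" 6 6 X Y] decomposable_K_6_6 assms less.prems by simp
  next
    case 3
    then obtain Z where Z: "Z \<subseteq> Y" "card Z = 4"
      using obtain_subset_with_card_n[of 4 Y] by auto
    then have fin: "finite Z" "finite (Y - Z)"
      using less.prems(1) finite_subset by auto
    have card: "card (Y - Z) = card Y - 4"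
      using Z fin by (simp add: card_Diff_subset)
    have 1: "decomposable (cross X Z)"
      using decomposable_transfer[of "{}" 6 4 X Z] decomposable_K_6_4 assms less.prems Z fin
      by auto
    have "X \<inter> (Y - Z) = {}"
      using less.prems(4) by blast
    then have 2: "decomposable (cross X (Y - Z))"
      using less.prems less.hyps[of "Y - Z"] 3 card fin by auto
    have "cross X Z \<inter> cross X (Y - Z) = {}"
      using less.prems(4) Z(1) by (auto simp: cross_def doubleton_eq_iff)
    then show ?thesis
      using decomposable_Un[OF 1 2] Z(1) cross_Un[of X Z "Y - Z"] by (simp add: Un_absorb1)
  qed
qed

lemma decomposable_extend:
  assumes "finite X" "card X = 6" "finite Y" "X \<inter> Y = {}" "card Y \<ge> 7"
  shows "decomposable (pairs_of X \<union> cross X Y)"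
proof (cases "even (card Y)")
  case True
  have "pairs_of X \<inter> cross X Y = {}"
    using assms(4) by (auto simp: pairs_of_def cross_def)
  then show ?thesis
    using decomposable_Un decomposable_pairs_of_6 decomposable_cross[of X Y] assms True by auto
next
  case False
  \<comment> \<open>An odd size of at least 7 leaves, after removing three vertices, an even size of
    at least 4, as the bipartite part requires.\<close>
  obtain Z where Z: "Z \<subseteq> Y" "card Z = 3"
    using obtain_subset_with_card_n[of 3 Y] assms(5) by auto
  then have fin: "finite Z" "finite (Y - Z)"
    using assms(3) finite_subset by auto
  have card: "card (Y - Z) = card Y - 3"
    using Z fin by (simp add: card_Diff_subset)
  \<comment> \<open>Selects the branch with \<open>pairs_of X\<close> in the conclusion of
    \<open>decomposable_transfer\<close>.\<close>
  have "pairs_of {0..<6::nat} \<noteq> {}"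
    using pairs_of_upto[of 6] by force
  then have 1: "decomposable (pairs_of X \<union> cross X Z)"
    using decomposable_transfer[of "pairs_of {0..<6}" 6 3 X Z] decomposable_K9_minus_K3 assms Z fin
    by auto
  have "X \<inter> (Y - Z) = {}"
    using assms(4) by blast
  then have 2: "decomposable (cross X (Y - Z))"
    using decomposable_cross[of X "Y - Z"] assms False card fin by auto
  have "(pairs_of X \<union> cross X Z) \<inter> cross X (Y - Z) = {}"
    using assms(4) Z(1) by (auto simp: cross_def pairs_of_def doubleton_eq_iff)
  then show ?thesis
    using decomposable_Un[OF 1 2] Z(1) cross_Un[of X Z "Y - Z"] by (simp add: Un_absorb1 Un_assoc)
qed

section \<open>Packings\<close>

lemma card_pairs_of: "finite V \<Longrightarrow> card (pairs_of V) = card V choose 2"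
  unfolding pairs_of_def by (rule n_subsets)

lemma finite_pairs_of: "finite V \<Longrightarrow> finite (pairs_of V)"
  unfolding pairs_of_def by simp

text \<open>Since vertices of a block are covered by its edges, lying inside the complete graph is a
  condition on edges alone. This makes the gluing of decompositions available for
  multipackings.\<close>

lemma multipacking_iff_decomposition:
  "multipacking hexagon prism (complete_graph n) P \<longleftrightarrow>
     decomposition P (\<Union>S\<in>P. edges S) \<and> (\<Union>S\<in>P. edges S) \<subseteq> pairs_of {0..<n} \<and>
     (\<exists>S\<in>P. graph_iso S hexagon) \<and> (\<exists>S\<in>P. graph_iso S prism)"
proof -
  have "subgraph S (complete_graph n) \<longleftrightarrow> edges S \<subseteq> pairs_of {0..<n}" if "is_block S" for S
  proof -
    have "verts S \<subseteq> {0..<n}" if "edges S \<subseteq> pairs_of {0..<n}"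
      using that verts_block[OF \<open>is_block S\<close>] by (auto simp: pairs_of_def)
    then show ?thesis
      using that by (auto simp: subgraph_def complete_graph_def)
  qed
  moreover have "simple_graph S" if "subgraph S (complete_graph n)" for S
    using that by (simp add: subgraph_def)
  ultimately have "(\<forall>S\<in>P. subgraph S (complete_graph n) \<and> (graph_iso S hexagon \<or> graph_iso S prism)) \<longleftrightarrow>
    (\<forall>S\<in>P. is_block S) \<and> (\<Union>S\<in>P. edges S) \<subseteq> pairs_of {0..<n}"
    by (simp only: UN_subset_iff) metis
  then show ?thesis
    unfolding multipacking_def decomposition_def by blast
qed

definition packable :: "nat \<Rightarrow> nat \<Rightarrow> bool" where
  "packable n k \<longleftrightarrow> (\<exists>P. multipacking hexagon prism (complete_graph n) P \<and>
     card (leave (complete_graph n) P) = k)"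

text \<open>Every premise can be evaluated. The last one gives the size of the leave because the
  listed pairs are distinct edges of \<open>K_n\<close>.\<close>

lemma packable_blocks:
  assumes "valid_blocks bs" "list_all (\<lambda>(a, b). b < n) (concat (map block_pairs bs))"
    and "list_ex fst bs" "list_ex (\<lambda>b. \<not> fst b) bs"
    and "length (concat (map block_pairs bs)) + k = n choose 2"
  shows "packable n k"
proof -
  let ?ps = "concat (map block_pairs bs)" and ?P = "block_graph ` set bs"
  have dec: "decomposition ?P (unordered ` set ?ps)" and less: "set ?ps \<subseteq> {(a, b). a < b}"
    using decomposition_blocks[OF assms(1)] by blast+
  have "set ?ps \<subseteq> {(a, b). a < b \<and> b < n}"
    using less assms(2) unfolding list_all_iff by blast
  then have sub: "unordered ` set ?ps \<subseteq> pairs_of {0..<n}"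
    unfolding pairs_of_upto by (rule image_mono)
  have E: "(\<Union>S\<in>?P. edges S) = unordered ` set ?ps"
    using dec unfolding decomposition_def by blast
  have iso: "graph_iso (block_graph b) (if fst b then hexagon else prism)" if "b \<in> set bs" for b
    using assms(1) that block_graph(2) unfolding valid_blocks_def by blast
  obtain b c where "b \<in> set bs" "fst b" "c \<in> set bs" "\<not> fst c"
    using assms(3,4) unfolding list_ex_iff by blast
  then have "\<exists>S\<in>?P. graph_iso S hexagon" "\<exists>S\<in>?P. graph_iso S prism"
    using iso[of b] iso[of c] by auto
  then have "multipacking hexagon prism (complete_graph n) ?P"
    unfolding multipacking_iff_decomposition E using dec sub by blast
  moreover have "card (leave (complete_graph n) ?P) = k"
  proof -
    have "card (unordered ` set ?ps) = length ?ps"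
      using assms(1) inj_on_subset[OF inj_on_unordered less]
      by (simp only: card_image valid_blocks_def distinct_card)
    then show ?thesis
      unfolding leave_def E using sub assms(5) card_pairs_of[of "{0..<n}"]
      by (simp add: complete_graph_def card_Diff_subset)
  qed
  ultimately show ?thesis
    unfolding packable_def by blast
qed

text \<open>All edges at the six new vertices are used, so the leave stays the same set. Both kinds
  of block already occur in \<open>P\<close>, so the added blocks may be of any kind.\<close>

lemma packable_add_6:
  assumes "packable n k" "n \<ge> 7"
  shows "packable (n + 6) k"
proof -
  let ?X = "{n..<n + 6}"
  let ?D = "pairs_of ?X \<union> cross ?X {0..<n}"
  obtain P where P: "multipacking hexagon prism (complete_graph n) P"
    and card: "card (leave (complete_graph n) P) = k"
    using assms(1) unfolding packable_def by blast
  let ?E = "\<Union>S\<in>P. edges S"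
  have E: "decomposition P ?E" "?E \<subseteq> pairs_of {0..<n}"
    and iso: "\<exists>S\<in>P. graph_iso S hexagon" "\<exists>S\<in>P. graph_iso S prism"
    using P unfolding multipacking_iff_decomposition by blast+
  obtain Q where Q: "decomposition Q ?D"
    using decomposable_extend[of ?X "{0..<n}"] assms(2) unfolding decomposable_def by auto
  have disj: "pairs_of {0..<n} \<inter> ?D = {}"
  proof -
    have "\<exists>u\<in>e. n \<le> u" if "e \<in> ?D" for e
      using that by (auto simp: pairs_of_def cross_def card_2_iff)
    moreover have "\<forall>u\<in>e. u < n" if "e \<in> pairs_of {0..<n}" for e
      using that by (auto simp: pairs_of_def)
    ultimately show ?thesis
      by (meson disjoint_iff leD)
  qed
  have union: "pairs_of {0..<n + 6} = pairs_of {0..<n} \<union> ?D"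
    using pairs_of_Un_disjoint[of ?X "{0..<n}"] ivl_disj_un_two(3)[of 0 n "n + 6"]
    by (simp add: Un_ac)
  have PQ: "decomposition (P \<union> Q) (?E \<union> ?D)"
    using decomposition_Un[OF E(1) Q] E(2) disj by blast
  then have U: "(\<Union>S\<in>P \<union> Q. edges S) = ?E \<union> ?D"
    unfolding decomposition_def by blast
  have "multipacking hexagon prism (complete_graph (n + 6)) (P \<union> Q)"
    unfolding multipacking_iff_decomposition U using PQ E(2) union iso by blast
  moreover have "leave (complete_graph (n + 6)) (P \<union> Q) = leave (complete_graph n) P"
    unfolding leave_def U using union disj E(2) by (auto simp: complete_graph_def)
  ultimately show ?thesis
    unfolding packable_def using card by metis
qed

section \<open>Explicit packings for small orders\<close>

lemma packable_8: "packable 8 1"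
proof (rule packable_blocks)
  show "valid_blocks [(False, [1,0,2,3,4,7]), (True, [0,1,5,7,6,2]), (True, [1,7,4,5,3,6]),
      (True, [3,4,6,0,5,2])]"
    by code_simp
qed code_simp+

lemma packable_11: "packable 11 1"
proof (rule packable_blocks)
  show "valid_blocks [(False, [7,5,2,10,9,1]), (False, [10,0,9,4,3,8]), (False, [8,3,6,5,7,2]),
      (False, [6,7,5,1,0,4]), (True, [0,1,9,6,4,2]), (True, [4,9,0,10,8,3]), (True, [2,10,6,3,1,8])]"
    by code_simp
qed code_simp+

text \<open>A hexagon and its complement fill a \<open>K_6\<close>; the leave is the star of six
  edges at the remaining vertex.\<close>

lemma packable_7: "packable 7 6"
proof (rule packable_blocks)
  show "valid_blocks [(True, [0,1,2,3,4,5]), (False, [0,1,2,3,4,5])]"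
    by code_simp
qed code_simp+

lemma packable_9: "packable 9 3"
proof (rule packable_blocks)
  show "valid_blocks [(False, [4,7,2,1,0,5]), (True, [1,2,6,8,4,3]), (True, [4,7,3,8,0,6]),
      (True, [0,3,6,1,8,5]), (True, [2,3,5,6,7,8])]"
    by code_simp
qed code_simp+

lemma packable_10: "packable 10 3"
proof (rule packable_blocks)
  show "valid_blocks [(False, [1,8,4,0,5,2]), (False, [3,6,2,0,9,5]), (True, [1,2,6,3,4,7]),
      (True, [0,4,6,7,8,9]), (True, [4,9,7,3,1,8]), (True, [3,8,6,1,9,5])]"
    by code_simp
qed code_simp+

lemma packable_add_mult_6: "packable n k \<Longrightarrow> n \<ge> 7 \<Longrightarrow> packable (n + 6 * m) k"
proof (induction m)
  case (Suc m)
  then show ?case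
    using packable_add_6[of "n + 6 * m" k] by (simp add: algebra_simps)
qed simp

lemma packable_2_mod_3:
  assumes "n mod 3 = 2" "n \<ge> 8"
  shows "packable n 1"
proof -
  \<comment> \<open>Residue 2 modulo 3 means residue 2 or 5 modulo 6, the classes of 8 and
    11.\<close>
  have "\<exists>m. n = 8 + 6 * m \<or> n = 11 + 6 * m"
    using assms by presburger
  then show ?thesis
    using packable_add_mult_6[OF packable_8] packable_add_mult_6[OF packable_11] by auto
qed

section \<open>Lower bounds\<close>

locale hexagon_prism_packing =
  fixes n :: nat and P :: "nat graph set"
  assumes multipacking: "multipacking hexagon prism (complete_graph n) P"
begin

definition hexagons :: "nat graph set" where
  "hexagons = {S \<in> P. graph_iso S hexagon}"

definition prisms :: "nat graph set" where
  "prisms = {S \<in> P. graph_iso S prism}"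

lemma simple_graph: "S \<in> P \<Longrightarrow> simple_graph S"
  using multipacking unfolding multipacking_def subgraph_def by blast

lemma edges_subset: "S \<in> P \<Longrightarrow> edges S \<subseteq> pairs_of {0..<n}"
  using multipacking unfolding multipacking_def subgraph_def complete_graph_def by simp

lemma verts_subset: "S \<in> P \<Longrightarrow> verts S \<subseteq> {0..<n}"
  using multipacking unfolding multipacking_def subgraph_def complete_graph_def by simp

lemma disjoint: "S \<in> P \<Longrightarrow> T \<in> P \<Longrightarrow> S \<noteq> T \<Longrightarrow> edges S \<inter> edges T = {}"
  using multipacking unfolding multipacking_def by blast

lemma hexagonD:
  assumes "S \<in> hexagons"
  shows "card (edges S) = 6" and "v \<in> verts S \<Longrightarrow> degree S v = 2"
proof -
  obtain f where f: "inj_on f (verts hexagon)" "S = copy f hexagon"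
    using graph_isoE[of S hexagon] assms simple_graph simple_graph_hexagon
    unfolding hexagons_def by blast
  show "card (edges S) = 6"
    using card_image[OF inj_on_image_edges[OF simple_graph_hexagon f(1)]] card_edges_hexagon
    by (simp add: f(2) copy_def)
  assume "v \<in> verts S"
  then obtain u where "u \<in> verts hexagon" "v = f u"
    unfolding f(2) copy_def by auto
  then show "degree S v = 2"
    using degree_copy[OF simple_graph_hexagon f(1)] degree_hexagon f(2) by metis
qed

lemma prismD:
  assumes "S \<in> prisms"
  shows "card (edges S) = 9" and "card (verts S) = 6" and "v \<in> verts S \<Longrightarrow> degree S v = 3"
proof -
  obtain f where f: "inj_on f (verts prism)" "S = copy f prism"
    using graph_isoE[of S prism] assms simple_graph simple_graph_prism
    unfolding prisms_def by blast
  show "card (edges S) = 9"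
    using card_image[OF inj_on_image_edges[OF simple_graph_prism f(1)]] card_edges_prism
    by (simp add: f(2) copy_def)
  show "card (verts S) = 6"
    using card_image[OF f(1)] by (simp add: f(2) copy_def verts_prism)
  assume "v \<in> verts S"
  then obtain u where "u \<in> verts prism" "v = f u"
    unfolding f(2) copy_def by auto
  then show "degree S v = 3"
    using degree_copy[OF simple_graph_prism f(1)] degree_prism f(2) by metis
qed

lemma P_eq: "P = hexagons \<union> prisms"
  using multipacking unfolding multipacking_def hexagons_def prisms_def by blast

text \<open>The edge counts 6 and 9 tell the two kinds apart.\<close>

lemma hexagons_prisms_disjoint: "hexagons \<inter> prisms = {}"
  using hexagonD(1) prismD(1) by fastforce

lemma finite_P: "finite P"
proof (rule finite_subset)
  show "P \<subseteq> Pow {0..<n} \<times> Pow (pairs_of {0..<n})"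
    using verts_subset edges_subset by (simp add: subset_iff mem_Times_iff)
qed (simp add: finite_pairs_of)

lemma finite_hexagons: "finite hexagons" and finite_prisms: "finite prisms"
  using finite_P by (simp_all add: hexagons_def prisms_def)

lemma card_pos: "card hexagons \<ge> 1" "card prisms \<ge> 1"
proof -
  have "hexagons \<noteq> {}" "prisms \<noteq> {}"
    using multipacking unfolding multipacking_def hexagons_def prisms_def by blast+
  then show "card hexagons \<ge> 1" "card prisms \<ge> 1"
    using finite_hexagons finite_prisms by (simp_all add: Suc_leI card_gt_0_iff)
qed

lemma sum_P:
  "(\<Sum>S\<in>P. g S) = (\<Sum>S\<in>hexagons. g S) + (\<Sum>S\<in>prisms. g S :: nat)"
  by (subst P_eq) (rule sum.union_disjoint[OF finite_hexagons finite_prisms hexagons_prisms_disjoint])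

text \<open>The edge count from which all lower bounds start, in additive form to avoid truncated
  subtraction.\<close>

lemma card_leave:
  "card (leave (complete_graph n) P) + 6 * card hexagons + 9 * card prisms = n choose 2"
proof -
  have "card (\<Union>S\<in>P. edges S) = (\<Sum>S\<in>P. card (edges S))"
    using finite_P simple_graph simple_graph_finite_edges disjoint
    by (intro card_UN_disjoint) auto
  also have "\<dots> = 6 * card hexagons + 9 * card prisms"
    unfolding sum_P by (simp add: hexagonD(1) prismD(1))
  finally have "card (\<Union>S\<in>P. edges S) = 6 * card hexagons + 9 * card prisms" .
  moreover have sub: "(\<Union>S\<in>P. edges S) \<subseteq> pairs_of {0..<n}"
    using edges_subset by blast
  moreover have "card (\<Union>S\<in>P. edges S) \<le> card (pairs_of {0..<n})"
    using sub by (intro card_mono finite_pairs_of) auto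
  moreover have "finite (\<Union>S\<in>P. edges S)"
    using sub finite_subset finite_pairs_of by blast
  ultimately show ?thesis
    using card_pairs_of[of "{0..<n}"]
    by (simp add: leave_def complete_graph_def card_Diff_subset)
qed

definition prisms_at :: "nat \<Rightarrow> nat graph set" where
  "prisms_at v = {S \<in> prisms. v \<in> verts S}"

text \<open>With every edge used, the \<open>n - 1\<close> edges at \<open>v\<close> are shared out
  by twos to the hexagons and by threes to the prisms through \<open>v\<close>. What matters later
  is the parity of \<open>card (prisms_at v)\<close>.\<close>

lemma degree_leave_empty:
  assumes "leave (complete_graph n) P = {}" "v < n"
  obtains m where "n - 1 = 2 * m + 3 * card (prisms_at v)"
proof -
  have deg0: "degree S v = 0" if "S \<in> P" "v \<notin> verts S" for S
    by (rule degree_notin_verts[OF simple_graph[OF that(1)] that(2)])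
  have E: "(\<Union>S\<in>P. edges S) = pairs_of {0..<n}"
  proof
    show "(\<Union>S\<in>P. edges S) \<subseteq> pairs_of {0..<n}"
      using edges_subset by blast
    show "pairs_of {0..<n} \<subseteq> (\<Union>S\<in>P. edges S)"
      using assms(1) by (simp add: leave_def complete_graph_def)
  qed
  have "{e \<in> pairs_of {0..<n}. v \<in> e} = (\<lambda>u. {u, v}) ` ({0..<n} - {v})"
  proof
    show "{e \<in> pairs_of {0..<n}. v \<in> e} \<subseteq> (\<lambda>u. {u, v}) ` ({0..<n} - {v})"
      by (auto simp: pairs_of_def card_2_iff)
    show "(\<lambda>u. {u, v}) ` ({0..<n} - {v}) \<subseteq> {e \<in> pairs_of {0..<n}. v \<in> e}"
      using assms(2) by (auto simp: pairs_of_def card_insert_if)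
  qed
  moreover have "inj_on (\<lambda>u. {u, v}) ({0..<n} - {v})"
    by (auto simp: inj_on_def doubleton_eq_iff)
  ultimately have "n - 1 = card {e \<in> pairs_of {0..<n}. v \<in> e}"
    using assms(2) by (simp add: card_image)
  also have "{e \<in> pairs_of {0..<n}. v \<in> e} = (\<Union>S\<in>P. {e \<in> edges S. v \<in> e})"
    unfolding E[symmetric] by blast
  also have "card \<dots> = (\<Sum>S\<in>P. degree S v)"
    unfolding degree_def
  proof (rule card_UN_disjoint)
    show "\<forall>S\<in>P. finite {e \<in> edges S. v \<in> e}"
      using simple_graph_finite_edges[OF simple_graph] by simp
    show "\<forall>S\<in>P. \<forall>T\<in>P. S \<noteq> T \<longrightarrow> {e \<in> edges S. v \<in> e} \<inter> {e \<in> edges T. v \<in> e} = {}"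
      using disjoint by blast
  qed (rule finite_P)
  also have "\<dots> = (\<Sum>S\<in>hexagons. degree S v) + (\<Sum>S\<in>prisms. degree S v)"
    by (rule sum_P)
  also have "(\<Sum>S\<in>prisms. degree S v) = (\<Sum>S\<in>prisms_at v. degree S v)"
  proof (rule sum.mono_neutral_right[OF finite_prisms])
    show "prisms_at v \<subseteq> prisms"
      unfolding prisms_at_def by blast
    show "\<forall>S\<in>prisms - prisms_at v. degree S v = 0"
      using deg0 by (simp add: prisms_at_def prisms_def)
  qed
  also have "\<dots> = 3 * card (prisms_at v)"
    by (simp add: prisms_at_def prismD(3))
  \<comment> \<open>Each hexagon contributes 2 or 0, so this sum is even; half of it is the
    \<open>m\<close> obtained.\<close>
  also have "(\<Sum>S\<in>hexagons. degree S v) = (\<Sum>S\<in>hexagons. 2 * (if v \<in> verts S then 1 else 0))"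
    using deg0 hexagonD(2) by (intro sum.cong) (simp_all add: hexagons_def)
  also have "\<dots> = 2 * (\<Sum>S\<in>hexagons. if v \<in> verts S then 1 else 0)"
    by (simp add: sum_distrib_left)
  finally show ?thesis
    by (rule that)
qed

section \<open>Bounds for the individual orders\<close>

lemma card_leave_eq_0: "card (leave (complete_graph n) P) = 0 \<Longrightarrow> leave (complete_graph n) P = {}"
  by (simp add: leave_def complete_graph_def finite_pairs_of)

text \<open>Both kinds of block have a multiple of three edges, while \<open>n choose 2\<close> is
  not divisible by three.\<close>

lemma card_leave_2_mod_3:
  assumes "n mod 3 = 2"
  shows "card (leave (complete_graph n) P) \<ge> 1"
proof (rule ccontr)
  assume "\<not> ?thesis"
  then have "n choose 2 = 6 * card hexagons + 9 * card prisms"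
    using card_leave by simp
  moreover have "2 * (n choose 2) = n * (n - 1)"
    unfolding choose_two by (cases "even n") auto
  moreover obtain k where "n = 3 * k + 2"
    using assms by (metis mult_div_mod_eq)
  \<comment> \<open>The count is doubled to clear the division in the binomial coefficient. The
    right-hand side is \<open>(3 * k + 2) * (3 * k + 1)\<close>, which is 2 modulo 3.\<close>
  ultimately have "12 * card hexagons + 18 * card prisms = 3 * (3 * k * k + 3 * k) + 2"
    by (simp add: algebra_simps)
  then show False
    by presburger
qed

lemma card_leave_7:
  assumes "n = 7"
  shows "card (leave (complete_graph n) P) \<ge> 6"
proof (rule ccontr)
  let ?l = "card (leave (complete_graph n) P)"
  assume "\<not> ?l \<ge> 6"
  moreover have "?l + 6 * card hexagons + 9 * card prisms = 21"
    using card_leave by (simp add: assms choose_two)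
  \<comment> \<open>With both kinds present the blocks use 15 or 21 edges, and a leave below 6
    excludes 15. The total 21 is two hexagons and one prism.\<close>
  ultimately have "?l = 0" "card prisms = 1"
    using card_pos by presburger+
  then obtain S where S: "prisms = {S}"
    by (auto simp: card_1_singleton_iff)
  then have "S \<in> prisms"
    by simp
  then have "card (verts S) = 6" "verts S \<subseteq> {0..<n}"
    using prismD(2) verts_subset by (simp_all add: prisms_def)
  then obtain v where v: "v \<in> verts S" "v < n"
    by (metis all_not_in_conv atLeastLessThan_iff card.empty subsetD zero_neq_numeral)
  then have "prisms_at v = {S}"
    using S by (auto simp: prisms_at_def)
  then obtain m where "6 = 2 * m + (3 :: nat)"
    using degree_leave_empty[OF card_leave_eq_0[OF \<open>?l = 0\<close>] v(2)] assms by auto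
  then show False
    by presburger
qed

lemma card_leave_9:
  assumes "n = 9"
  shows "card (leave (complete_graph n) P) \<ge> 3"
proof (rule ccontr)
  let ?l = "card (leave (complete_graph n) P)"
  assume "\<not> ?l \<ge> 3"
  moreover have "?l + 6 * card hexagons + 9 * card prisms = 36"
    using card_leave by (simp add: assms choose_two)
  \<comment> \<open>Divisibility by three makes the leave empty. Then the number of prisms is even,
    and four prisms would leave no room for a hexagon.\<close>
  ultimately have "?l = 0" "card prisms = 2"
    using card_pos by presburger+
  then obtain S T where ST: "prisms = {S, T}" "S \<noteq> T"
    by (auto simp: card_2_iff)
  then have inP: "S \<in> P" "T \<in> P"
    by (auto simp: prisms_def)
  \<comment> \<open>The degree 8 is even, so \<open>v\<close> lies in both prisms or in
    neither.\<close>
  have "v \<in> verts S \<longleftrightarrow> v \<in> verts T" if v: "v < n" for v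
  proof -
    obtain m where m: "8 = 2 * m + 3 * card (prisms_at v)"
      using degree_leave_empty[OF card_leave_eq_0[OF \<open>?l = 0\<close>] v] assms by auto
    have "prisms_at v = (if v \<in> verts S then {S} else {}) \<union> (if v \<in> verts T then {T} else {})"
      using ST(1) by (auto simp: prisms_at_def)
    then have "card (prisms_at v) = (if v \<in> verts S then 1 else 0) + (if v \<in> verts T then 1 else 0)"
      using ST(2) by simp
    then show ?thesis
      using m by (auto split: if_splits) presburger+
  qed
  then have "verts S = verts T"
    using verts_subset[OF inP(1)] verts_subset[OF inP(2)] by fastforce
  then have sub: "edges S \<union> edges T \<subseteq> pairs_of (verts S)"
    using simple_graph[OF inP(1)] simple_graph[OF inP(2)] by (simp add: simple_graph_def)
  have "finite (verts S)"
    using simple_graph[OF inP(1)] by (simp add: simple_graph_def)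
  then have "card (edges S \<union> edges T) \<le> 15"
    using card_mono[OF finite_pairs_of sub] prismD(2)[of S] ST(1)
    by (simp add: card_pairs_of choose_two)
  moreover have "card (edges S \<union> edges T) = 18"
    using card_Un_disjoint[OF _ _ disjoint[OF inP ST(2)]] prismD(1)[of S] prismD(1)[of T] ST(1)
      simple_graph_finite_edges[OF simple_graph[OF inP(1)]]
      simple_graph_finite_edges[OF simple_graph[OF inP(2)]] by simp
  ultimately show False
    by simp
qed

text \<open>Deleting two vertices of degree 3 destroys at most six of the nine edges.\<close>

lemma prism_edges_within:
  assumes "S \<in> prisms" "W \<subseteq> verts S" "card W = 4"
  shows "card (edges S \<inter> pairs_of W) \<ge> 3"
proof -
  have S: "simple_graph S"
    using assms(1) simple_graph by (simp add: prisms_def)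
  have fin: "finite (verts S)"
    using S by (simp add: simple_graph_def)
  then have "finite W"
    using assms(2) finite_subset by blast
  then have "card (verts S - W) = 2"
    using prismD(2)[OF assms(1)] assms(2,3) by (simp add: card_Diff_subset)
  then obtain x y where xy: "verts S - W = {x, y}"
    by (auto simp: card_2_iff)
  have "edges S \<subseteq> (edges S \<inter> pairs_of W) \<union> {e \<in> edges S. x \<in> e} \<union> {e \<in> edges S. y \<in> e}"
  proof
    fix e assume e: "e \<in> edges S"
    then have "e \<subseteq> verts S" "card e = 2"
      using S by (auto simp: simple_graph_def pairs_of_def)
    moreover have "verts S \<subseteq> insert x (insert y W)"
      using xy by blast
    ultimately have "e \<in> pairs_of W" if "x \<notin> e" "y \<notin> e"
      using that unfolding pairs_of_def by blast
    then show "e \<in> (edges S \<inter> pairs_of W) \<union> {e \<in> edges S. x \<in> e} \<union> {e \<in> edges S. y \<in> e}"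
      using e by blast
  qed
  then have "card (edges S) \<le> card ((edges S \<inter> pairs_of W) \<union> {e \<in> edges S. x \<in> e} \<union> {e \<in> edges S. y \<in> e})"
    using simple_graph_finite_edges[OF S] by (intro card_mono) auto
  also have "\<dots> \<le> card ((edges S \<inter> pairs_of W) \<union> {e \<in> edges S. x \<in> e}) + degree S y"
    unfolding degree_def by (rule card_Un_le)
  also have "\<dots> \<le> card (edges S \<inter> pairs_of W) + degree S x + degree S y"
    unfolding degree_def by (intro add_mono card_Un_le) simp
  finally have "card (edges S) \<le> card (edges S \<inter> pairs_of W) + degree S x + degree S y" .
  moreover have "degree S x = 3" "degree S y = 3"
    using prismD(3)[OF assms(1)] xy by blast+
  ultimately show ?thesis
    using prismD(1)[OF assms(1)] by simp
qed

lemma card_leave_10: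
  assumes "n = 10"
  shows "card (leave (complete_graph n) P) \<ge> 3"
proof (rule ccontr)
  let ?l = "card (leave (complete_graph n) P)"
  assume "\<not> ?l \<ge> 3"
  moreover have "?l + 6 * card hexagons + 9 * card prisms = 45"
    using card_leave by (simp add: assms choose_two)
  \<comment> \<open>The leave is divisible by three, hence empty. The number of prisms is then odd,
    and five prisms would use all 45 edges without a hexagon.\<close>
  ultimately have "?l = 0" and prisms: "card prisms = 1 \<or> card prisms = 3"
    using card_pos by presburger+
  have odd: "odd (card (prisms_at v))" if v: "v < n" for v
  proof -
    obtain m where "9 = 2 * m + 3 * card (prisms_at v)"
      using degree_leave_empty[OF card_leave_eq_0[OF \<open>?l = 0\<close>] v] assms by auto
    then show ?thesis
      by presburger
  qed
  have le: "card (prisms_at v) \<le> card prisms" for v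
    using finite_prisms by (auto simp: prisms_at_def intro: card_mono)
  define W where "W = {v \<in> {0..<n}. card (prisms_at v) = 3}"
  \<comment> \<open>Incidences between vertices and prisms are counted twice; each prism has six
    vertices.\<close>
  have "(\<Sum>v\<in>{0..<n}. card (prisms_at v)) = (\<Sum>v\<in>{0..<n}. \<Sum>S\<in>prisms. if v \<in> verts S then 1 else (0::nat))"
    using finite_prisms by (simp add: prisms_at_def sum.If_cases Int_def)
  also have "\<dots> = (\<Sum>S\<in>prisms. \<Sum>v\<in>{0..<n}. if v \<in> verts S then 1 else 0)"
    by (rule sum.swap)
  also have "\<dots> = (\<Sum>S\<in>prisms. 6)"
  proof (rule sum.cong)
    fix S assume S: "S \<in> prisms"
    then have "{0..<n} \<inter> verts S = verts S"
      using verts_subset[of S] by (auto simp: prisms_def)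
    then show "(\<Sum>v\<in>{0..<n}. if v \<in> verts S then 1 else (0::nat)) = 6"
      using prismD(2)[OF S] by (simp add: sum.If_cases Int_def)
  qed simp
  finally have sum: "(\<Sum>v\<in>{0..<n}. card (prisms_at v)) = 6 * card prisms"
    by simp
  \<comment> \<open>An odd number of at most three prisms is 1 or 3, so \<open>W\<close> collects
    all the exceptions to 1.\<close>
  have "card (prisms_at v) = 1 + 2 * (if card (prisms_at v) = 3 then 1 else 0)" if "v < n" for v
    using odd[OF that] le[of v] prisms by presburger
  then have "(\<Sum>v\<in>{0..<n}. card (prisms_at v))
      = (\<Sum>v\<in>{0..<n}. 1 + 2 * (if card (prisms_at v) = 3 then 1 else 0))"
    by (intro sum.cong) auto
  also have "\<dots> = n + 2 * card W"
    unfolding W_def sum.distrib sum_distrib_left[symmetric] by (simp add: sum.If_cases Int_def)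
  \<comment> \<open>The equation is \<open>10 + 2 * card W = 6 * card prisms\<close>; a single prism
    would make the right side too small.\<close>
  finally have "card prisms = 3" "card W = 4"
    using sum prisms assms by presburger+
  have "W \<subseteq> verts S" if "S \<in> prisms" for S
  proof
    fix v assume "v \<in> W"
    then have "prisms_at v = prisms"
      using \<open>card prisms = 3\<close> finite_prisms
      by (intro card_subset_eq) (auto simp: W_def prisms_at_def)
    then show "v \<in> verts S"
      using that by (auto simp: prisms_at_def)
  qed
  then have within: "card (edges S \<inter> pairs_of W) \<ge> 3" if "S \<in> prisms" for S
    using prism_edges_within that \<open>card W = 4\<close> by blast
  have "finite W"
    by (simp add: W_def)
  \<comment> \<open>Three edge-disjoint prisms would put at least nine edges inside
    \<open>W\<close>, which has only six pairs.\<close>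
  have "9 \<le> (\<Sum>S\<in>prisms. card (edges S \<inter> pairs_of W))"
    using sum_bounded_below[of prisms 3 "\<lambda>S. card (edges S \<inter> pairs_of W)"] within \<open>card prisms = 3\<close> by simp
  also have "\<dots> = card (\<Union>S\<in>prisms. edges S \<inter> pairs_of W)"
  proof (rule card_UN_disjoint[symmetric])
    show "\<forall>S\<in>prisms. \<forall>T\<in>prisms. S \<noteq> T \<longrightarrow> edges S \<inter> pairs_of W \<inter> (edges T \<inter> pairs_of W) = {}"
      using disjoint unfolding prisms_def by blast
  qed (use finite_prisms finite_pairs_of[OF \<open>finite W\<close>] in auto)
  also have "\<dots> \<le> card (pairs_of W)"
    by (rule card_mono[OF finite_pairs_of[OF \<open>finite W\<close>]]) blast
  also have "\<dots> = 6"
    using card_pairs_of[OF \<open>finite W\<close>] \<open>card W = 4\<close> by (simp add: choose_two)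
  finally show False
    by simp
qed

end

section \<open>From packings and bounds to maximum multipackings\<close>

text \<open>A lower bound that is attained is the minimum. Existence is included so that the
  statement about all maximum multipackings is not vacuous.\<close>

lemma maximum_multipacking_card_leave:
  assumes "packable n k"
    and "\<And>P. multipacking hexagon prism (complete_graph n) P \<Longrightarrow> k \<le> card (leave (complete_graph n) P)"
  shows "(\<exists>P. maximum_multipacking hexagon prism (complete_graph n) P) \<and>
    (\<forall>P. maximum_multipacking hexagon prism (complete_graph n) P \<longrightarrow>
       card (leave (complete_graph n) P) = k)"
proof -
  obtain Q where Q: "multipacking hexagon prism (complete_graph n) Q"
      "card (leave (complete_graph n) Q) = k"
    using assms(1) unfolding packable_def by blast
  then have "maximum_multipacking hexagon prism (complete_graph n) Q"
    using assms(2) unfolding maximum_multipacking_def by blast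
  moreover have "card (leave (complete_graph n) P) = k"
    if "maximum_multipacking hexagon prism (complete_graph n) P" for P
    using that Q assms(2) unfolding maximum_multipacking_def by (metis le_antisym)
  ultimately show ?thesis
    by blast
qed

theorem theorem2:
  shows
    "(\<forall>n::nat. n mod 3 = 2 \<and> n \<ge> 8 \<longrightarrow>
        (\<exists>P. maximum_multipacking (cycle_graph 6) (complement (cycle_graph 6)) (complete_graph n) P) \<and>
        (\<forall>P. maximum_multipacking (cycle_graph 6) (complement (cycle_graph 6)) (complete_graph n) P \<longrightarrow>
           card (leave (complete_graph n) P) = 1)) \<and>
     ((\<exists>P. maximum_multipacking (cycle_graph 6) (complement (cycle_graph 6)) (complete_graph 7) P) \<and>
        (\<forall>P. maximum_multipacking (cycle_graph 6) (complement (cycle_graph 6)) (complete_graph 7) P \<longrightarrow>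
           card (leave (complete_graph 7) P) = 6)) \<and>
     (\<forall>n\<in>{9, 10}.
        (\<exists>P. maximum_multipacking (cycle_graph 6) (complement (cycle_graph 6)) (complete_graph n) P) \<and>
        (\<forall>P. maximum_multipacking (cycle_graph 6) (complement (cycle_graph 6)) (complete_graph n) P \<longrightarrow>
           card (leave (complete_graph n) P) = 3))"
\<comment> \<open>The instances of \<open>conjI\<close> separate the cases of the theorem but keep
  each existence claim together with its leave size, the form that
  \<open>maximum_multipacking_card_leave\<close> delivers.\<close>
proof (intro conjI[of "All _"] conjI[of "Ex _ \<and> _"] allI impI ballI)
  note bound = hexagon_prism_packing.intro
  show "(\<exists>P. maximum_multipacking hexagon prism (complete_graph n) P) \<and>
      (\<forall>P. maximum_multipacking hexagon prism (complete_graph n) P \<longrightarrow>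
         card (leave (complete_graph n) P) = 1)" if "n mod 3 = 2 \<and> n \<ge> 8" for n
    using that
    by (intro maximum_multipacking_card_leave packable_2_mod_3
        hexagon_prism_packing.card_leave_2_mod_3[OF bound]) auto
  show "(\<exists>P. maximum_multipacking hexagon prism (complete_graph 7) P) \<and>
      (\<forall>P. maximum_multipacking hexagon prism (complete_graph 7) P \<longrightarrow>
         card (leave (complete_graph 7) P) = 6)"
    by (intro maximum_multipacking_card_leave packable_7
        hexagon_prism_packing.card_leave_7[OF bound]) auto
  show "(\<exists>P. maximum_multipacking hexagon prism (complete_graph n) P) \<and>
      (\<forall>P. maximum_multipacking hexagon prism (complete_graph n) P \<longrightarrow>
         card (leave (complete_graph n) P) = 3)" if "n \<in> {9, 10}" for n
    using that packable_9 packable_10 hexagon_prism_packing.card_leave_9[OF bound]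
      hexagon_prism_packing.card_leave_10[OF bound]
    by (intro maximum_multipacking_card_leave) auto
qed

end
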